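(* For each pair $(e,f)$ with $0<f<e<1$, the rotation number $\hat\rho(e,f)$ of the confocal Poncelet (billiard) circle map $B_e^f:E(f)\to E(f)$ is $$\hat\rho(e,f)=\frac{F(\hat\omega(e,f),e)}{2K(e)},\qquad \hat\omega(e,f)=\arcsin\sqrt{\frac{e^2-f^2}{e^2(1-f^2)}}.$$
   Context: For $0<\varepsilon<1$ let $E(\varepsilon)=\{(x,y)\in\mathbb R^2:\varepsilon^2x^2+\frac{\varepsilon^2}{1-\varepsilon^2}y^2=1\}$, the ellipse of eccentricity $\varepsilon$ with foci $(\pm1,0)$. If $0<f<e<1$ then $E(e)$ lies in the interior of $E(f)$. Confocal Poncelet map: for $0<f<e<1$ and $z_0\in E(f)$, $B_e^f(z_0)=z_1$ is the unique point of $E(f)$ such that the segment from $z_0$ to $z_1$ is tangent to $E(e)$ with $E(e)$ on the left when moving from $z_0$ to $z_1$. (These are the orbits, with counterclockwise orientation and caustic $E(e)$, of the billiard in the domain bounded by $E(f)$.) Elliptic integrals: $F(\phi,e)=\int_0^\phi\frac{d\tau}{\sqrt{1-e^2\sin^2\tau}}$ and $K(e)=F(\pi/2,e)$. Rotation number: $E(f)$ is oriented counterclockwise and identified with $\mathbb R/\mathbb Z$ by an orientation-preserving homeomorphism; the rotation number of an orientation-preserving circle homeomorphism with lift $G:\mathbb R\to\mathbb R$ is $\lim_{n\to\infty}(G^n(x)-x)/n$ modulo $1$, with the representative taken in $[0,1)$. *)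

theory Defs
  imports "HOL-Complex_Analysis.Complex_Analysis"
begin

definition conic_form :: "real \<Rightarrow> real \<times> real \<Rightarrow> real" where
  "conic_form \<epsilon> p = \<epsilon>\<^sup>2 * (fst p)\<^sup>2 + \<epsilon>\<^sup>2 / (1 - \<epsilon>\<^sup>2) * (snd p)\<^sup>2"

definition conf_ellipse :: "real \<Rightarrow> (real \<times> real) set" where
  "conf_ellipse \<epsilon> = {p. conic_form \<epsilon> p = 1}"

(* The ellipse is a regular level set, so its tangent direction at p spans the kernel
   of the derivative of the defining function at p. *)
definition segment_tangent :: "real \<Rightarrow> real \<times> real \<Rightarrow> real \<times> real \<Rightarrow> bool" where
  "segment_tangent \<epsilon> z w \<longleftrightarrow> z \<noteq> w \<and>
     (\<exists>p \<in> closed_segment z w \<inter> conf_ellipse \<epsilon>.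
        frechet_derivative (conic_form \<epsilon>) (at p) (w - z) = 0)"

definition cross2 :: "real \<times> real \<Rightarrow> real \<times> real \<Rightarrow> real" where
  "cross2 u v = fst u * snd v - snd u * fst v"

(* The inequality is weak because the point of tangency lies on the directed line itself. *)
definition on_left :: "(real \<times> real) set \<Rightarrow> real \<times> real \<Rightarrow> real \<times> real \<Rightarrow> bool" where
  "on_left S z w \<longleftrightarrow> (\<forall>p\<in>S. 0 \<le> cross2 (w - z) (p - z))"

(* Only the values at points of conf_ellipse f are meaningful. *)
definition poncelet_map :: "real \<Rightarrow> real \<Rightarrow> real \<times> real \<Rightarrow> real \<times> real" where
  "poncelet_map e f z =
     (THE w. w \<in> conf_ellipse f \<and> segment_tangent e z w \<and> on_left (conf_ellipse e) z w)"

(* The interval integral is oriented, so negative amplitudes get the usual sign. *)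
definition ellipticF :: "real \<Rightarrow> real \<Rightarrow> real" where
  "ellipticF \<phi> e = (LBINT \<tau>=0..\<phi>. 1 / sqrt (1 - e\<^sup>2 * (sin \<tau>)\<^sup>2))"

definition ellipticK :: "real \<Rightarrow> real" where
  "ellipticK e = ellipticF (pi / 2) e"

(* An orientation-preserving homeomorphism from R/Z onto the closed curve S, given as a
   1-periodic map on R.  A continuous bijection from the compact R/Z onto S is automatically
   a homeomorphism.  S is oriented counterclockwise around the origin, which it is assumed
   to enclose. *)
definition circle_coordinate :: "(real \<times> real) set \<Rightarrow> (real \<Rightarrow> real \<times> real) \<Rightarrow> bool" where
  "circle_coordinate S c \<longleftrightarrow>
     continuous_on UNIV c \<and> range c = S \<and> (\<forall>s t. c s = c t \<longleftrightarrow> s - t \<in> \<int>) \<and>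
     winding_number (\<lambda>t. Complex (fst (c t)) (snd (c t))) 0 = 1"

(* The existence of such a G says exactly that T restricts to an orientation-preserving
   homeomorphism of the curve parametrized by c. *)
definition circle_lift ::
  "(real \<Rightarrow> real \<times> real) \<Rightarrow> (real \<times> real \<Rightarrow> real \<times> real) \<Rightarrow> (real \<Rightarrow> real) \<Rightarrow> bool" where
  "circle_lift c T G \<longleftrightarrow>
     continuous_on UNIV G \<and> strict_mono G \<and> (\<forall>x. G (x + 1) = G x + 1) \<and>
     (\<forall>x. c (G x) = T (c x))"

(* The value must be the same for all coordinates, lifts and base points; the first conjunct
   excludes the vacuous case.  Since frac takes values in [0,1), so does the rotation number. *)
definition has_rotation_number ::
  "(real \<times> real) set \<Rightarrow> (real \<times> real \<Rightarrow> real \<times> real) \<Rightarrow> real \<Rightarrow> bool" where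
  "has_rotation_number S T \<rho> \<longleftrightarrow>
     (\<exists>c G. circle_coordinate S c \<and> circle_lift c T G) \<and>
     (\<forall>c G x. circle_coordinate S c \<and> circle_lift c T G \<longrightarrow>
        (\<exists>L. (\<lambda>n. ((G ^^ n) x - x) / real n) \<longlonglongrightarrow> L \<and> frac L = \<rho>))"

lemma has_rotation_number_unique:
  assumes "has_rotation_number S T \<rho>" and "has_rotation_number S T \<sigma>"
  shows "\<rho> = \<sigma>"
proof -
  obtain c G where cG: "circle_coordinate S c \<and> circle_lift c T G"
    using assms(1) unfolding has_rotation_number_def by blast
  let ?a = "\<lambda>n. ((G ^^ n) 0 - 0) / real n"
  have "\<exists>L. ?a \<longlonglongrightarrow> L \<and> frac L = \<rho>" and "\<exists>L. ?a \<longlonglongrightarrow> L \<and> frac L = \<sigma>"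
    using assms cG unfolding has_rotation_number_def by blast+
  then show ?thesis
    using LIMSEQ_unique by blast
qed

definition rotation_angle :: "real \<Rightarrow> real \<Rightarrow> real" where
  "rotation_angle e f = arcsin (sqrt ((e\<^sup>2 - f\<^sup>2) / (e\<^sup>2 * (1 - f\<^sup>2))))"

end

theory Submission
  imports Defs
begin

text \<open>The billiard in \<open>E(f)\<close> with caustic \<open>E(e)\<close> becomes a rigid rotation once points of \<open>E(f)\<close> are
parametrized by Jacobi's elliptic functions of modulus \<open>e\<close>, the eccentricity of the caustic:
the parameter \<open>u\<close> stands for the point whose angle from the \<open>y\<close>-axis (before the circle is stretched
to \<open>E(f)\<close>) is the amplitude of \<open>u\<close>. Write \<open>v = F(\<omega>, e)\<close>, where \<open>\<omega>\<close> is the angle in the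
theorem.

The axes of the two confocal ellipses have ratios \<open>dn v / cn v\<close> and \<open>1 / cn v\<close>. With these
ratios, the addition theorem for sn, cn and dn says precisely that the chord of \<open>E(f)\<close> joining the
parameters \<open>m - v\<close> and \<open>m + v\<close> touches \<open>E(e)\<close> at the point of \<open>E(e)\<close> with parameter \<open>m\<close>. An affine map turns \<open>E(e)\<close>
into the unit circle, where the tangent chord with the circle on its left is seen to be determined by
its starting point (\<open>poncelet_map_eqI\<close>). So the billiard map is the translation
\<open>u \<mapsto> u + 2 v\<close> (\<open>poncelet_map_ellipse_param\<close>). A full turn changes the parameter by \<open>4 K\<close>, and the rotation number is
\<open>2 v / (4 K) = v / (2 K)\<close>.

The value must come out the same for every coordinate and every lift. An arbitrary
coordinate admits a continuous angle of degree one (\<open>circle_coordinate_lift\<close>), and composing the angle with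
Legendre's integral gives a map of the line that carries the given lift to a
translation by \<open>v / (2 K)\<close> plus an integer and moves points by a bounded amount. Such a map preserves
the mean displacement (\<open>linear_growth_limit\<close>).\<close>

section \<open>Legendre's integral and its inverse\<close>

definition ell_delta :: "real \<Rightarrow> real \<Rightarrow> real" where
  "ell_delta k \<phi> = sqrt (1 - k\<^sup>2 * (sin \<phi>)\<^sup>2)"

definition jacobi_am :: "real \<Rightarrow> real \<Rightarrow> real" where
  "jacobi_am k = inv (\<lambda>\<phi>. ellipticF \<phi> k)"

definition jacobi_sn :: "real \<Rightarrow> real \<Rightarrow> real" where
  "jacobi_sn k u = sin (jacobi_am k u)"

definition jacobi_cn :: "real \<Rightarrow> real \<Rightarrow> real" where
  "jacobi_cn k u = cos (jacobi_am k u)"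

definition jacobi_dn :: "real \<Rightarrow> real \<Rightarrow> real" where
  "jacobi_dn k u = ell_delta k (jacobi_am k u)"

lemma ellipticF_zero [simp]: "ellipticF 0 k = 0"
  unfolding ellipticF_def zero_ereal_def by (rule interval_integral_endpoints_same)

text \<open>The condition on the modulus keeps the integrand of Legendre's integral smooth and at least 1 on
the whole line; hence the integral is a diffeomorphism of \<open>\<real>\<close> and Jacobi's functions
are defined at every real argument.\<close>

locale elliptic_modulus =
  fixes k :: real
  assumes modulus: "k\<^sup>2 < 1"
begin

lemma delta_radicand_pos: "0 < 1 - k\<^sup>2 * (sin \<phi>)\<^sup>2"
proof -
  have "k\<^sup>2 * (sin \<phi>)\<^sup>2 \<le> k\<^sup>2 * 1"
    by (intro mult_left_mono) (auto simp: abs_square_le_1)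
  with modulus show ?thesis by simp
qed

lemma ell_delta_pos: "0 < ell_delta k \<phi>"
  using delta_radicand_pos by (simp add: ell_delta_def)

lemma ell_delta_le_1: "ell_delta k \<phi> \<le> 1"
  unfolding ell_delta_def by (rule real_le_lsqrt) auto

lemma ell_delta_squared: "(ell_delta k \<phi>)\<^sup>2 = 1 - k\<^sup>2 * (sin \<phi>)\<^sup>2"
  using delta_radicand_pos[of \<phi>] by (simp add: ell_delta_def)

lemma continuous_inverse_delta: "continuous_on S (\<lambda>\<phi>. 1 / ell_delta k \<phi>)"
  unfolding ell_delta_def
  by (intro continuous_intros) (metis delta_radicand_pos less_irrefl real_sqrt_eq_zero_cancel_iff)

lemma ellipticF_has_derivative:
  "((\<lambda>\<phi>. ellipticF \<phi> k) has_real_derivative 1 / ell_delta k \<phi>) (at \<phi>)"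
proof -
  define M where "M = \<bar>\<phi>\<bar> + 1"
  have "((\<lambda>u. LBINT \<tau>=ereal 0..u. 1 / ell_delta k \<tau>) has_vector_derivative 1 / ell_delta k \<phi>)
          (at \<phi> within {-M..M})"
    by (rule interval_integral_FTC2) (auto simp: M_def continuous_inverse_delta)
  then have "((\<lambda>\<phi>. ellipticF \<phi> k) has_vector_derivative 1 / ell_delta k \<phi>) (at \<phi> within {-M..M})"
    unfolding ellipticF_def ell_delta_def zero_ereal_def by simp
  moreover have "at \<phi> within {-M..M} = at \<phi>"
    by (rule at_within_interior) (auto simp: M_def)
  ultimately show ?thesis
    by (simp add: has_real_derivative_iff_has_vector_derivative)
qed

lemmas ellipticF_derivative [derivative_intros] =
  DERIV_chain2[OF ellipticF_has_derivative]

lemma ellipticF_continuous: "isCont (\<lambda>\<phi>. ellipticF \<phi> k) \<phi>"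
  using ellipticF_has_derivative by (rule DERIV_isCont)

lemma ellipticF_strict_mono: "strict_mono (\<lambda>\<phi>. ellipticF \<phi> k)"
  unfolding strict_mono_def
proof (intro allI impI)
  fix x y :: real assume "x < y"
  then show "ellipticF x k < ellipticF y k"
    by (rule DERIV_pos_imp_increasing)
       (use ellipticF_has_derivative ell_delta_pos in \<open>blast intro: divide_pos_pos zero_less_one\<close>)
qed

lemma ellipticF_growth:
  assumes "x \<le> y" shows "y - x \<le> ellipticF y k - ellipticF x k"
proof -
  have "ellipticF x k - x \<le> ellipticF y k - y"
  proof (rule DERIV_nonneg_imp_nondecreasing[OF assms])
    fix t
    show "\<exists>d. ((\<lambda>t. ellipticF t k - t) has_real_derivative d) (at t) \<and> 0 \<le> d"
      by (rule exI[of _ "1 / ell_delta k t - 1"])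
         (auto intro!: derivative_eq_intros simp: ell_delta_pos ell_delta_le_1)
  qed
  then show ?thesis by simp
qed

lemma ellipticF_surj: "surj (\<lambda>\<phi>. ellipticF \<phi> k)"
proof -
  have "\<exists>x. ellipticF x k = y" for y
  proof -
    have "\<exists>x\<ge>-\<bar>y\<bar>. x \<le> \<bar>y\<bar> \<and> ellipticF x k = y"
      using ellipticF_growth[of "-\<bar>y\<bar>" 0] ellipticF_growth[of 0 "\<bar>y\<bar>"]
      by (intro IVT) (auto simp: ellipticF_continuous)
    then show ?thesis by blast
  qed
  then show ?thesis unfolding surj_def by metis
qed

lemma ellipticF_am [simp]: "ellipticF (jacobi_am k u) k = u"
  unfolding jacobi_am_def using ellipticF_surj by (rule surj_f_inv_f)

lemma am_ellipticF [simp]: "jacobi_am k (ellipticF \<phi> k) = \<phi>"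
  unfolding jacobi_am_def
  using strict_mono_imp_inj_on[OF ellipticF_strict_mono] by (rule inv_f_f)

lemma am_zero [simp]: "jacobi_am k 0 = 0"
  by (metis am_ellipticF ellipticF_zero)

lemma am_continuous: "isCont (jacobi_am k) u"
proof -
  have "isCont (jacobi_am k) (ellipticF (jacobi_am k u) k)"
    by (rule isCont_inverse_function[where d = 1]) (auto simp: ellipticF_continuous)
  then show ?thesis by simp
qed

lemma am_has_derivative: "(jacobi_am k has_real_derivative jacobi_dn k u) (at u)"
proof -
  have "DERIV (jacobi_am k) u :> inverse (1 / ell_delta k (jacobi_am k u))"
  proof (rule DERIV_inverse_function[where f = "\<lambda>\<phi>. ellipticF \<phi> k" and a = "u - 1" and b = "u + 1"])
    show "1 / ell_delta k (jacobi_am k u) \<noteq> 0"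
      using ell_delta_pos[of "jacobi_am k u"] by simp
  qed (auto simp: ellipticF_has_derivative am_continuous)
  then show ?thesis by (simp add: jacobi_dn_def)
qed

text \<open>The integrand is even and \<open>\<pi>\<close>-periodic; this is how a full turn of the amplitude comes to
cost \<open>4 K\<close>, although \<open>K\<close> is defined by a quarter turn.\<close>

lemma ellipticF_reflect: "ellipticF (pi - \<phi>) k = ellipticF pi k - ellipticF \<phi> k"
proof -
  have "\<forall>x. ((\<lambda>x. ellipticF (pi - x) k + ellipticF x k) has_real_derivative 0) (at x)"
    by (auto intro!: derivative_eq_intros simp: ell_delta_def)
  from DERIV_isconst_all[OF this, of \<phi> 0] show ?thesis by simp
qed

lemma ellipticF_pi: "ellipticF pi k = 2 * ellipticK k"
  using ellipticF_reflect[of "pi/2"] by (simp add: ellipticK_def)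

lemma ellipticF_shift_pi: "ellipticF (\<phi> + pi) k = ellipticF \<phi> k + 2 * ellipticK k"
proof -
  have "\<forall>x. ((\<lambda>x. ellipticF (x + pi) k - ellipticF x k) has_real_derivative 0) (at x)"
    by (auto intro!: derivative_eq_intros simp: ell_delta_def)
  from DERIV_isconst_all[OF this, of \<phi> 0] show ?thesis by (simp add: ellipticF_pi)
qed

lemma ellipticF_shift_period: "ellipticF (\<phi> + 2 * pi) k = ellipticF \<phi> k + 4 * ellipticK k"
  using ellipticF_shift_pi[of \<phi>] ellipticF_shift_pi[of "\<phi> + pi"] by (simp add: add.assoc)

lemma ellipticF_shift_periods:
  "ellipticF (\<phi> + 2 * pi * of_int n) k = ellipticF \<phi> k + 4 * ellipticK k * of_int n"
proof (induction n rule: int_induct[where k = 0])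
  case (step1 i)
  then show ?case
    using ellipticF_shift_period[of "\<phi> + 2 * pi * of_int i"] by (simp add: algebra_simps)
next
  case (step2 i)
  then show ?case
    using ellipticF_shift_period[of "\<phi> + 2 * pi * of_int (i - 1)"] by (simp add: algebra_simps)
qed simp

lemma am_shift_periods: "jacobi_am k (u + 4 * ellipticK k * of_int n) = jacobi_am k u + 2 * pi * of_int n"
  by (metis am_ellipticF ellipticF_am ellipticF_shift_periods)

lemma ellipticK_pos: "0 < ellipticK k"
  using ellipticF_strict_mono[THEN strict_monoD, of 0 "pi/2"] by (simp add: ellipticK_def)

lemma ellipticF_minus: "ellipticF (- \<phi>) k = - ellipticF \<phi> k"
  using ellipticF_reflect[of "-\<phi>"] ellipticF_shift_pi[of \<phi>] by (simp add: ellipticF_pi add.commute)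

lemma am_minus: "jacobi_am k (- u) = - jacobi_am k u"
  by (metis am_ellipticF ellipticF_am ellipticF_minus)

lemma sn_minus [simp]: "jacobi_sn k (- u) = - jacobi_sn k u"
  and cn_minus [simp]: "jacobi_cn k (- u) = jacobi_cn k u"
  and dn_minus [simp]: "jacobi_dn k (- u) = jacobi_dn k u"
  by (simp_all add: jacobi_sn_def jacobi_cn_def jacobi_dn_def ell_delta_def am_minus)

lemma sn_zero [simp]: "jacobi_sn k 0 = 0"
  and cn_zero [simp]: "jacobi_cn k 0 = 1"
  and dn_zero [simp]: "jacobi_dn k 0 = 1"
  by (simp_all add: jacobi_sn_def jacobi_cn_def jacobi_dn_def ell_delta_def)

lemma dn_pos: "0 < jacobi_dn k u"
  by (simp add: jacobi_dn_def ell_delta_pos)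

lemma sn_cn_squared: "(jacobi_sn k u)\<^sup>2 + (jacobi_cn k u)\<^sup>2 = 1"
  by (simp add: jacobi_sn_def jacobi_cn_def)

lemma dn_squared: "(jacobi_dn k u)\<^sup>2 = 1 - k\<^sup>2 * (jacobi_sn k u)\<^sup>2"
  by (simp add: jacobi_sn_def jacobi_dn_def ell_delta_squared)

lemma sn_has_derivative:
  "(jacobi_sn k has_real_derivative jacobi_cn k u * jacobi_dn k u) (at u)"
  unfolding jacobi_sn_def[abs_def] jacobi_cn_def
  by (auto intro!: derivative_eq_intros am_has_derivative)

lemma cn_has_derivative:
  "(jacobi_cn k has_real_derivative - jacobi_sn k u * jacobi_dn k u) (at u)"
  unfolding jacobi_cn_def[abs_def] jacobi_sn_def
  by (auto intro!: derivative_eq_intros am_has_derivative)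

lemma dn_has_derivative:
  "(jacobi_dn k has_real_derivative - k\<^sup>2 * jacobi_sn k u * jacobi_cn k u) (at u)"
proof -
  have dn: "jacobi_dn k = (\<lambda>u. sqrt (1 - k\<^sup>2 * (jacobi_sn k u)\<^sup>2))"
    by (simp add: fun_eq_iff jacobi_dn_def jacobi_sn_def ell_delta_def)
  have "((\<lambda>u. sqrt (1 - k\<^sup>2 * (jacobi_sn k u)\<^sup>2)) has_real_derivative
          (- (k\<^sup>2 * (2 * jacobi_sn k u * (jacobi_cn k u * jacobi_dn k u)))) * (inverse (jacobi_dn k u) / 2)) (at u)"
    using delta_radicand_pos[of "jacobi_am k u"]
    by (auto intro!: derivative_eq_intros sn_has_derivative simp: dn jacobi_sn_def[symmetric])
  also have "(- (k\<^sup>2 * (2 * jacobi_sn k u * (jacobi_cn k u * jacobi_dn k u)))) * (inverse (jacobi_dn k u) / 2)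
      = - k\<^sup>2 * jacobi_sn k u * jacobi_cn k u"
    using dn_pos[of u] by (simp add: field_simps)
  finally show ?thesis by (simp only: dn[symmetric])
qed

lemmas jacobi_derivatives [derivative_intros] =
  DERIV_chain2[OF sn_has_derivative] DERIV_chain2[OF cn_has_derivative]
  DERIV_chain2[OF dn_has_derivative]

section \<open>Addition theorem\<close>

lemma addition_denominator_pos: "0 < 1 - k\<^sup>2 * (jacobi_sn k u)\<^sup>2 * (jacobi_sn k v)\<^sup>2"
proof -
  have "k\<^sup>2 * (jacobi_sn k u)\<^sup>2 * (jacobi_sn k v)\<^sup>2 \<le> k\<^sup>2 * (jacobi_sn k u)\<^sup>2 * 1"
    by (intro mult_left_mono) (auto simp: abs_square_le_1 jacobi_sn_def)
  then show ?thesis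
    using delta_radicand_pos[of "jacobi_am k u"] by (simp add: jacobi_sn_def)
qed

lemma quotient_constant:
  fixes N D :: "real \<Rightarrow> real"
  assumes "\<And>t. (N has_real_derivative N' t) (at t)" "\<And>t. (D has_real_derivative D' t) (at t)"
    and "\<And>t. D t \<noteq> 0" "\<And>t. N' t * D t = N t * D' t"
  shows "N x / D x = N y / D y"
proof -
  have "((\<lambda>t. N t / D t) has_real_derivative 0) (at t)" for t
    using DERIV_divide[OF assms(1)[of t] assms(2)[of t] assms(3)[of t]] assms(4)[of t] by simp
  then show ?thesis using DERIV_isconst_all[of "\<lambda>t. N t / D t" x y] by blast
qed

text \<open>Classical addition formulas. Substituting \<open>c - u\<close> for \<open>v\<close> with \<open>c\<close> fixed turns each right-hand
side into a function of \<open>u\<close> alone. Its derivative vanishes, by a polynomial identity modulo the two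
quadratic relations between sn, cn and dn, so its value is the one at \<open>u = c\<close>, where \<open>v = 0\<close>.\<close>

lemma
  shows sn_add: "jacobi_sn k (u + v) =
      (jacobi_sn k u * jacobi_cn k v * jacobi_dn k v + jacobi_sn k v * jacobi_cn k u * jacobi_dn k u)
        / (1 - k\<^sup>2 * (jacobi_sn k u)\<^sup>2 * (jacobi_sn k v)\<^sup>2)" (is "_ = ?S")
    and cn_add: "jacobi_cn k (u + v) =
      (jacobi_cn k u * jacobi_cn k v - jacobi_sn k u * jacobi_sn k v * jacobi_dn k u * jacobi_dn k v)
        / (1 - k\<^sup>2 * (jacobi_sn k u)\<^sup>2 * (jacobi_sn k v)\<^sup>2)" (is "_ = ?C")
    and dn_add: "jacobi_dn k (u + v) =
      (jacobi_dn k u * jacobi_dn k v - k\<^sup>2 * jacobi_sn k u * jacobi_sn k v * jacobi_cn k u * jacobi_cn k v)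
        / (1 - k\<^sup>2 * (jacobi_sn k u)\<^sup>2 * (jacobi_sn k v)\<^sup>2)" (is "_ = ?D")
proof -
  let ?s = "jacobi_sn k" and ?c = "jacobi_cn k" and ?d = "jacobi_dn k"
  define c where "c = u + v"
  define D where "D t = 1 - k\<^sup>2 * (?s t)\<^sup>2 * (?s (c - t))\<^sup>2" for t
  define D' where "D' t = - 2 * k\<^sup>2 * ?s t * ?s (c - t) *
      (?c t * ?d t * ?s (c - t) - ?s t * ?c (c - t) * ?d (c - t))" for t
  have D: "(D has_real_derivative D' t) (at t)" for t
    unfolding D_def[abs_def] D'_def
    by (auto intro!: derivative_eq_intros simp: power2_eq_square algebra_simps)
  have D0: "D t \<noteq> 0" for t
    using addition_denominator_pos[of t "c - t"] by (simp add: D_def)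
  have "(\<lambda>t. ?s t * ?c (c - t) * ?d (c - t) + ?s (c - t) * ?c t * ?d t) u / D u
      = (\<lambda>t. ?s t * ?c (c - t) * ?d (c - t) + ?s (c - t) * ?c t * ?d t) c / D c"
    apply (rule quotient_constant[OF _ D D0])
     apply (rule derivative_eq_intros refl)+
    subgoal for t
      unfolding D'_def D_def
      using sn_cn_squared[of t] sn_cn_squared[of "c - t"] dn_squared[of t] dn_squared[of "c - t"]
      by algebra
    done
  then show "jacobi_sn k (u + v) = ?S" by (simp add: c_def D_def)
  have "(\<lambda>t. ?c t * ?c (c - t) - ?s t * ?s (c - t) * ?d t * ?d (c - t)) u / D u
      = (\<lambda>t. ?c t * ?c (c - t) - ?s t * ?s (c - t) * ?d t * ?d (c - t)) c / D c"
    apply (rule quotient_constant[OF _ D D0])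
     apply (rule derivative_eq_intros refl)+
    subgoal for t
      unfolding D'_def D_def
      using sn_cn_squared[of t] sn_cn_squared[of "c - t"] dn_squared[of t] dn_squared[of "c - t"]
      by algebra
    done
  then show "jacobi_cn k (u + v) = ?C" by (simp add: c_def D_def)
  have "(\<lambda>t. ?d t * ?d (c - t) - k\<^sup>2 * ?s t * ?s (c - t) * ?c t * ?c (c - t)) u / D u
      = (\<lambda>t. ?d t * ?d (c - t) - k\<^sup>2 * ?s t * ?s (c - t) * ?c t * ?c (c - t)) c / D c"
    apply (rule quotient_constant[OF _ D D0])
     apply (rule derivative_eq_intros refl)+
    subgoal for t
      unfolding D'_def D_def
      using sn_cn_squared[of t] sn_cn_squared[of "c - t"] dn_squared[of t] dn_squared[of "c - t"]
      by algebra
    done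
  then show "jacobi_dn k (u + v) = ?D" by (simp add: c_def D_def)
qed

text \<open>The next two identities are the addition theorem in the form that describes chords. Read for
fixed \<open>v\<close> and after division by cn \<open>v\<close>, they say that the point
\<open>(dn v / cn v * sn (u + v), cn (u + v) / cn v)\<close> lies on the tangent of the unit circle at
\<open>(sn u, cn u)\<close>, at signed distance \<open>sn v * dn (u + v) / cn v\<close> from the point of tangency.\<close>

lemma sn_add_dn:
  "jacobi_dn k v * jacobi_sn k (u + v)
     = jacobi_cn k v * jacobi_sn k u + jacobi_sn k v * jacobi_dn k (u + v) * jacobi_cn k u"
  unfolding sn_add dn_add
  using addition_denominator_pos[of u v] sn_cn_squared[of u] dn_squared[of v]
  apply (simp add: field_simps)
  by algebra

lemma cn_add_dn:
  "jacobi_cn k (u + v)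
     = jacobi_cn k v * jacobi_cn k u - jacobi_sn k v * jacobi_dn k (u + v) * jacobi_sn k u"
  unfolding cn_add dn_add
  using addition_denominator_pos[of u v] sn_cn_squared[of u]
  by (simp add: field_simps power2_eq_square)

end

section \<open>Chords tangent to an ellipse\<close>

text \<open>Affine coordinates in which the ellipse of eccentricity \<open>\<epsilon>\<close> is the unit circle. For
\<open>0 < \<epsilon> < 1\<close> the map has positive determinant, so it preserves sides of directed lines as well as tangency.\<close>

definition ellipse_coords :: "real \<Rightarrow> real \<Rightarrow> real \<Rightarrow> real \<times> real" where
  "ellipse_coords \<epsilon> X Y = (X / \<epsilon>, sqrt (1 - \<epsilon>\<^sup>2) / \<epsilon> * Y)"

lemma square_less_1: "0 < \<epsilon> \<Longrightarrow> \<epsilon> < 1 \<Longrightarrow> \<epsilon>\<^sup>2 < (1::real)"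
  by (simp add: power_less_one_iff)

lemma ellipse_coords_exist:
  assumes "0 < \<epsilon>" "\<epsilon> < 1"
  obtains X Y where "p = ellipse_coords \<epsilon> X Y"
proof
  show "p = ellipse_coords \<epsilon> (fst p * \<epsilon>) (snd p * \<epsilon> / sqrt (1 - \<epsilon>\<^sup>2))"
    using assms square_less_1[OF assms] by (simp add: ellipse_coords_def prod_eq_iff)
qed

lemma ellipse_coords_inject:
  assumes "0 < \<epsilon>" "\<epsilon> < 1"
  shows "ellipse_coords \<epsilon> X Y = ellipse_coords \<epsilon> X' Y' \<longleftrightarrow> X = X' \<and> Y = Y'"
  using assms square_less_1[OF assms] by (simp add: ellipse_coords_def)

lemma ellipse_coords_diff:
  "ellipse_coords \<epsilon> X Y - ellipse_coords \<epsilon> X' Y' = ellipse_coords \<epsilon> (X - X') (Y - Y')"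
  by (simp add: ellipse_coords_def diff_divide_distrib right_diff_distrib)

lemma ellipse_coords_convex:
  "(1 - t) *\<^sub>R ellipse_coords \<epsilon> X Y + t *\<^sub>R ellipse_coords \<epsilon> X' Y'
     = ellipse_coords \<epsilon> ((1 - t) * X + t * X') ((1 - t) * Y + t * Y')"
  by (simp add: ellipse_coords_def add_divide_distrib distrib_left mult.left_commute)

lemma conic_form_coords:
  assumes "0 < \<epsilon>" "\<epsilon> < 1"
  shows "conic_form \<delta> (ellipse_coords \<epsilon> X Y)
     = (\<delta> / \<epsilon>)\<^sup>2 * X\<^sup>2 + (\<delta> / \<epsilon>)\<^sup>2 * ((1 - \<epsilon>\<^sup>2) / (1 - \<delta>\<^sup>2)) * Y\<^sup>2"
  using square_less_1[OF assms]
  by (simp add: conic_form_def ellipse_coords_def power_mult_distrib power_divide ac_simps)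

lemma conic_form_own_coords:
  assumes "0 < \<epsilon>" "\<epsilon> < 1"
  shows "conic_form \<epsilon> (ellipse_coords \<epsilon> X Y) = X\<^sup>2 + Y\<^sup>2"
  using assms square_less_1[OF assms] by (simp add: conic_form_coords)

lemma conic_form_derivative:
  "frechet_derivative (conic_form \<epsilon>) (at p) d
     = 2 * (\<epsilon>\<^sup>2 * fst p * fst d + \<epsilon>\<^sup>2 / (1 - \<epsilon>\<^sup>2) * snd p * snd d)"
proof -
  have "((\<lambda>p. a * (fst p)\<^sup>2 + b * (snd p)\<^sup>2) has_derivative
      (\<lambda>d. 2 * (a * fst p * fst d + b * snd p * snd d))) (at p)" for a b :: real
    by (auto intro!: derivative_eq_intros simp: algebra_simps)
  from fun_cong[OF frechet_derivative_at[OF this[of "\<epsilon>\<^sup>2" "\<epsilon>\<^sup>2 / (1 - \<epsilon>\<^sup>2)", folded conic_form_def]]] show ?thesis by simp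
qed

lemma conic_form_derivative_coords:
  assumes "0 < \<epsilon>" "\<epsilon> < 1"
  shows "frechet_derivative (conic_form \<epsilon>) (at (ellipse_coords \<epsilon> X Y)) (ellipse_coords \<epsilon> U V)
     = 2 * (X * U + Y * V)"
  using assms square_less_1[OF assms]
  by (simp add: conic_form_derivative ellipse_coords_def power2_eq_square field_simps)

lemma cross2_coords:
  "cross2 (ellipse_coords \<epsilon> X Y) (ellipse_coords \<epsilon> U V) = sqrt (1 - \<epsilon>\<^sup>2) / \<epsilon>\<^sup>2 * (X * V - Y * U)"
  by (simp add: cross2_def ellipse_coords_def power2_eq_square diff_divide_distrib algebra_simps)

text \<open>In the coordinates of \<open>E(e)\<close> the point of tangency \<open>(X, Y)\<close> is a unit vector and \<open>(- Y, X)\<close> is the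
counterclockwise tangent direction there. A tangent segment keeps the ellipse on its left exactly
when it runs along this direction, so it starts \<open>s\<close> units behind the point of tangency and ends
\<open>r\<close> units beyond it.\<close>

lemma tangent_segment_left_iff:
  assumes e: "0 < e" "e < 1"
  shows "segment_tangent e z w \<and> on_left (conf_ellipse e) z w \<longleftrightarrow>
    (\<exists>X Y s r. X\<^sup>2 + Y\<^sup>2 = 1 \<and> 0 \<le> s \<and> 0 \<le> r \<and> 0 < s + r \<and>
       z = ellipse_coords e (X + s * Y) (Y - s * X) \<and> w = ellipse_coords e (X - r * Y) (Y + r * X))"
    (is "_ \<longleftrightarrow> ?chord")
proof -
  let ?E = "ellipse_coords e"
  define \<kappa> where "\<kappa> = sqrt (1 - e\<^sup>2) / e\<^sup>2"
  have \<kappa>: "0 < \<kappa>" using e square_less_1[OF e] by (simp add: \<kappa>_def)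
  show ?thesis
  proof
    assume L: "segment_tangent e z w \<and> on_left (conf_ellipse e) z w"
    obtain Z1 Z2 where z: "z = ?E Z1 Z2" using ellipse_coords_exist[OF e] .
    obtain W1 W2 where w: "w = ?E W1 W2" using ellipse_coords_exist[OF e] .
    from L obtain t where t: "0 \<le> t" "t \<le> 1" and ne: "z \<noteq> w"
      and on: "conic_form e ((1 - t) *\<^sub>R z + t *\<^sub>R w) = 1"
      and tang: "frechet_derivative (conic_form e) (at ((1 - t) *\<^sub>R z + t *\<^sub>R w)) (w - z) = 0"
      by (auto simp: segment_tangent_def conf_ellipse_def closed_segment_def)
    define X where "X = (1 - t) * Z1 + t * W1"
    define Y where "Y = (1 - t) * Z2 + t * W2"
    have p: "(1 - t) *\<^sub>R z + t *\<^sub>R w = ?E X Y"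
      by (simp add: z w ellipse_coords_convex X_def Y_def)
    have unit: "X\<^sup>2 + Y\<^sup>2 = 1" using on by (simp add: p conic_form_own_coords[OF e])
    have orth: "X * (W1 - Z1) + Y * (W2 - Z2) = 0"
      using tang[unfolded p] by (simp add: z w ellipse_coords_diff conic_form_derivative_coords[OF e])
    define l where "l = X * (W2 - Z2) - Y * (W1 - Z1)"
    have d1: "W1 - Z1 = - l * Y" using unit orth unfolding l_def by algebra
    have d2: "W2 - Z2 = l * X" using unit orth unfolding l_def by algebra
    have Z: "Z1 = X + (t * l) * Y" "Z2 = Y - (t * l) * X"
      using d1 d2 unfolding X_def Y_def by algebra+
    have W: "W1 = X - ((1 - t) * l) * Y" "W2 = Y + ((1 - t) * l) * X"
      using d1 d2 Z by algebra+
    \<comment> \<open>The antipode of the point of tangency decides the side.\<close>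
    have "?E (- X) (- Y) \<in> conf_ellipse e"
      using unit by (simp add: conf_ellipse_def conic_form_own_coords[OF e])
    with L have "0 \<le> cross2 (w - z) (?E (- X) (- Y) - z)" by (auto simp: on_left_def)
    also have "\<dots> = \<kappa> * (2 * l)"
    proof -
      have "(W1 - Z1) * (- Y - Z2) - (W2 - Z2) * (- X - Z1) = 2 * l"
        using unit unfolding d1 d2 unfolding Z by algebra
      then show ?thesis
        by (simp add: z w ellipse_coords_diff cross2_coords \<kappa>_def)
    qed
    finally have "0 \<le> l" using \<kappa> by (simp add: zero_le_mult_iff)
    moreover have "l \<noteq> 0" using ne d1 d2 by (auto simp: z w)
    ultimately have l: "0 < l" by simp
    show ?chord
    proof (intro exI conjI)
      show "0 < t * l + (1 - t) * l" using l by (simp add: algebra_simps)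
    qed (use unit t l Z W in \<open>auto simp: z w\<close>)
  next
    assume ?chord
    then obtain X Y s r where unit: "X\<^sup>2 + Y\<^sup>2 = 1" and sr: "0 \<le> s" "0 \<le> r" "0 < s + r"
      and z: "z = ?E (X + s * Y) (Y - s * X)" and w: "w = ?E (X - r * Y) (Y + r * X)"
      by blast
    have wz: "w - z = ?E (- (s + r) * Y) ((s + r) * X)"
      by (simp add: z w ellipse_coords_diff algebra_simps)
    have "z \<noteq> w"
    proof
      assume "z = w"
      then have "(s + r) * Y = 0" "(s + r) * X = 0"
        by (auto simp: z w ellipse_coords_inject[OF e] algebra_simps)
      then show False using sr unit by auto
    qed
    moreover have "?E X Y \<in> closed_segment z w"
    proof -
      define t where "t = s / (s + r)"
      have ts: "s - t * (s + r) = 0" using sr by (simp add: t_def)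
      have "(1 - t) * (X + s * Y) + t * (X - r * Y) = X + (s - t * (s + r)) * Y"
           "(1 - t) * (Y - s * X) + t * (Y + r * X) = Y - (s - t * (s + r)) * X"
        by (simp_all add: algebra_simps)
      then have "?E X Y = (1 - t) *\<^sub>R z + t *\<^sub>R w"
        by (simp add: z w ellipse_coords_convex ts)
      moreover have "0 \<le> t" "t \<le> 1" using sr by (auto simp: t_def field_simps)
      ultimately show ?thesis by (auto simp: closed_segment_def)
    qed
    moreover have "?E X Y \<in> conf_ellipse e"
      using unit by (simp add: conf_ellipse_def conic_form_own_coords[OF e])
    moreover have "frechet_derivative (conic_form e) (at (?E X Y)) (w - z) = 0"
      unfolding wz by (simp add: conic_form_derivative_coords[OF e] algebra_simps)
    ultimately have "segment_tangent e z w" by (auto simp: segment_tangent_def)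
    moreover have "on_left (conf_ellipse e) z w"
      unfolding on_left_def
    proof
      fix q assume q: "q \<in> conf_ellipse e"
      obtain U V where UV: "q = ?E U V" using ellipse_coords_exist[OF e] .
      with q have unit': "U\<^sup>2 + V\<^sup>2 = 1"
        by (simp add: conf_ellipse_def conic_form_own_coords[OF e])
      have "2 * (1 - (X * U + Y * V)) = (X - U)\<^sup>2 + (Y - V)\<^sup>2"
        using unit unit' by algebra
      moreover have "\<dots> \<ge> 0" by simp
      ultimately have "0 \<le> 2 * (1 - (X * U + Y * V))" by (simp only:)
      then have "0 \<le> 1 - (X * U + Y * V)" by (simp only: zero_le_mult_iff) simp
      then have "0 \<le> \<kappa> * ((s + r) * (1 - (X * U + Y * V)))"
        using \<kappa> sr by simp
      also have "(s + r) * (1 - (X * U + Y * V))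
          = - (s + r) * Y * (V - (Y - s * X)) - (s + r) * X * (U - (X + s * Y))"
        using unit by algebra
      finally show "0 \<le> cross2 (w - z) (q - z)"
        unfolding wz by (simp add: UV z ellipse_coords_diff cross2_coords \<kappa>_def)
    qed
    ultimately show "segment_tangent e z w \<and> on_left (conf_ellipse e) z w" ..
  qed
qed

lemma quadratic_third_root:
  fixes a b c x y z :: real
  assumes "a \<noteq> 0" "a * x\<^sup>2 + b * x + c = 0" "a * y\<^sup>2 + b * y + c = 0" "a * z\<^sup>2 + b * z + c = 0"
    and "x \<noteq> y" "x \<noteq> z"
  shows "y = z"
proof -
  have "(x - y) * (a * (x + y) + b) = 0" "(x - z) * (a * (x + z) + b) = 0"
    using assms(2-4) by algebra+
  with assms(5,6) have "a * (x + y) + b = 0" "a * (x + z) + b = 0" by simp_all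
  then have "a * (y - z) = 0" by algebra
  with assms(1) show ?thesis by simp
qed

lemma unit_from_tangent_vector:
  fixes X Y U V s :: real
  assumes "X + s * Y = U + s * V" "Y - s * X = V - s * U"
  shows "X = U \<and> Y = V"
proof -
  have "(1 + s\<^sup>2) * (X - U) = 0" "(1 + s\<^sup>2) * (Y - V) = 0"
    using assms by algebra+
  moreover have "1 + s\<^sup>2 \<noteq> 0" by (metis add_pos_nonneg less_irrefl zero_le_power2 zero_less_one)
  ultimately show ?thesis by simp
qed

text \<open>A chord of \<open>E(f)\<close> that touches \<open>E(e)\<close> is the only candidate for the image of its starting point.
For a competing chord from the same point, Pythagoras gives the same distance to the point of
tangency, since the squared norm of the starting point is \<open>1 + s\<^sup>2\<close>; distance and starting point
determine the point of tangency. Both chords therefore lie on one line. The equation of \<open>E(f)\<close> on that line is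
quadratic with root \<open>- s\<close>, and it has at most one other root.\<close>

lemma poncelet_map_eqI:
  assumes f: "0 < f" "f < 1" and e: "0 < e" "e < 1"
    and unit: "X\<^sup>2 + Y\<^sup>2 = 1" and s: "0 < s" and r: "0 < r"
    and z: "z = ellipse_coords e (X + s * Y) (Y - s * X)" "z \<in> conf_ellipse f"
    and w: "w = ellipse_coords e (X - r * Y) (Y + r * X)" "w \<in> conf_ellipse f"
  shows "poncelet_map e f z = w"
  unfolding poncelet_map_def
proof (rule the_equality)
  have "segment_tangent e z w \<and> on_left (conf_ellipse e) z w"
    unfolding tangent_segment_left_iff[OF e]
    by (rule exI[of _ X], rule exI[of _ Y], rule exI[of _ s], rule exI[of _ r]) (use assms in auto)
  then show "w \<in> conf_ellipse f \<and> segment_tangent e z w \<and> on_left (conf_ellipse e) z w"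
    using w by blast
next
  fix w' assume w': "w' \<in> conf_ellipse f \<and> segment_tangent e z w' \<and> on_left (conf_ellipse e) z w'"
  then obtain X' Y' s' r' where unit': "X'\<^sup>2 + Y'\<^sup>2 = 1" and sr': "0 \<le> s'" "0 \<le> r'"
    and z': "z = ellipse_coords e (X' + s' * Y') (Y' - s' * X')"
    and w'': "w' = ellipse_coords e (X' - r' * Y') (Y' + r' * X')"
    using tangent_segment_left_iff[OF e, of z w'] by blast
  have eq: "X' + s' * Y' = X + s * Y" "Y' - s' * X' = Y - s * X"
    using z' z(1) by (simp_all add: ellipse_coords_inject[OF e])
  have "s'\<^sup>2 = s\<^sup>2" using eq unit unit' by algebra
  with s sr' have s': "s' = s" by simp
  have XY: "X' = X" "Y' = Y" using unit_from_tangent_vector[OF eq[unfolded s']] by auto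
  define \<alpha> where "\<alpha> = (f / e)\<^sup>2"
  define \<beta> where "\<beta> = (f / e)\<^sup>2 * ((1 - e\<^sup>2) / (1 - f\<^sup>2))"
  have pos: "0 < \<alpha>" "0 < \<beta>"
    using e f square_less_1[OF e] square_less_1[OF f] by (auto simp: \<alpha>_def \<beta>_def)
  define a where "a = \<alpha> * Y\<^sup>2 + \<beta> * X\<^sup>2"
  have "a \<noteq> 0"
  proof -
    have "X \<noteq> 0 \<or> Y \<noteq> 0" using unit by auto
    then have "0 < a" unfolding a_def using pos
      by (auto intro: add_pos_nonneg add_nonneg_pos)
    then show ?thesis by simp
  qed
  have root: "a * x\<^sup>2 + 2 * (\<beta> - \<alpha>) * X * Y * x + (\<alpha> * X\<^sup>2 + \<beta> * Y\<^sup>2 - 1) = 0"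
    if "ellipse_coords e (X - x * Y) (Y + x * X) \<in> conf_ellipse f" for x
  proof -
    have "\<alpha> * (X - x * Y)\<^sup>2 + \<beta> * (Y + x * X)\<^sup>2 = 1"
      using that by (simp add: conf_ellipse_def conic_form_coords[OF e] \<alpha>_def \<beta>_def)
    then show ?thesis unfolding a_def by algebra
  qed
  have "r' = r"
  proof (rule quadratic_third_root[where x = "- s"])
    show "a * (- s)\<^sup>2 + 2 * (\<beta> - \<alpha>) * X * Y * - s + (\<alpha> * X\<^sup>2 + \<beta> * Y\<^sup>2 - 1) = 0"
      using z by (intro root) simp
    show "a * r'\<^sup>2 + 2 * (\<beta> - \<alpha>) * X * Y * r' + (\<alpha> * X\<^sup>2 + \<beta> * Y\<^sup>2 - 1) = 0"
      using w' w'' XY by (intro root) simp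
    show "a * r\<^sup>2 + 2 * (\<beta> - \<alpha>) * X * Y * r + (\<alpha> * X\<^sup>2 + \<beta> * Y\<^sup>2 - 1) = 0"
      using w by (intro root) simp
  qed (use \<open>a \<noteq> 0\<close> s r sr' in auto)
  then show "w' = w" using w'' w(1) XY by simp
qed

section \<open>The billiard map in elliptic coordinates\<close>

text \<open>The angle is measured counterclockwise from the positive \<open>y\<close>-axis: Jacobi's amplitude at modulus
\<open>e\<close> linearises the billiard from this origin, whereas the usual eccentric angle differs by a quarter turn.\<close>

definition ellipse_param :: "real \<Rightarrow> real \<Rightarrow> real \<times> real" where
  "ellipse_param \<epsilon> \<theta> = ellipse_coords \<epsilon> (- sin \<theta>) (cos \<theta>)"

lemma ellipse_param_mem:
  assumes "0 < \<epsilon>" "\<epsilon> < 1"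
  shows "ellipse_param \<epsilon> \<theta> \<in> conf_ellipse \<epsilon>"
  using assms by (simp add: ellipse_param_def conf_ellipse_def conic_form_own_coords)

text \<open>With \<open>v = F(\<omega>, e)\<close>, the value of \<open>\<omega>\<close> is the one for which \<open>dn v / cn v = e / f\<close> is the ratio of the
major axes of \<open>E(f)\<close> and \<open>E(e)\<close>, and \<open>1 / cn v\<close> the ratio of the minor ones. The two identities
\<open>sn_add_dn\<close> and \<open>cn_add_dn\<close> then place the points of \<open>E(f)\<close> with parameters \<open>m - v\<close> and \<open>m + v\<close> on the
tangent of \<open>E(e)\<close> at its point with parameter \<open>m\<close>, on opposite sides of it. Hence one bounce adds \<open>2 v\<close>
to the parameter.\<close>

lemma poncelet_map_ellipse_param:
  assumes "0 < f" "f < e" "e < 1"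
  shows "poncelet_map e f (ellipse_param f (jacobi_am e u))
     = ellipse_param f (jacobi_am e (u + 2 * ellipticF (rotation_angle e f) e))"
proof -
  have e: "0 < e" "e < 1" and f: "0 < f" "f < 1" using assms by auto
  have e2: "e\<^sup>2 < 1" and f2: "f\<^sup>2 < 1" using square_less_1[OF e] square_less_1[OF f] .
  have fe2: "f\<^sup>2 < e\<^sup>2" using assms by (simp add: power_strict_mono)
  interpret elliptic_modulus e by unfold_locales (rule e2)
  define S where "S = (e\<^sup>2 - f\<^sup>2) / (e\<^sup>2 * (1 - f\<^sup>2))"
  define v where "v = ellipticF (rotation_angle e f) e"
  \<comment> \<open>The parameter of the point of tangency.\<close>
  define m where "m = u + v"
  have S1: "1 - S = (f / e)\<^sup>2 * ((1 - e\<^sup>2) / (1 - f\<^sup>2))"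
    using e f f2 by (simp add: S_def field_simps power2_eq_square)
  have eS: "1 - e\<^sup>2 * S = (1 - e\<^sup>2) / (1 - f\<^sup>2)"
    using e f2 by (simp add: S_def field_simps)
  have S: "0 < S" "S < 1"
  proof -
    show "0 < S" using fe2 f2 e by (simp add: S_def)
    have "0 < 1 - S" unfolding S1 using e f e2 f2 by simp
    then show "S < 1" by simp
  qed
  have om: "rotation_angle e f = arcsin (sqrt S)" by (simp add: rotation_angle_def S_def)
  have snv: "jacobi_sn e v = sqrt S"
    using S by (simp add: jacobi_sn_def v_def om order_trans[OF _ real_sqrt_ge_zero])
  have cnv: "jacobi_cn e v = sqrt (1 - S)"
    using S by (simp add: jacobi_cn_def v_def om cos_arcsin order_trans[OF _ real_sqrt_ge_zero])
  have dnv: "jacobi_dn e v = sqrt (1 - e\<^sup>2 * S)"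
    using S snv by (simp add: jacobi_dn_def ell_delta_def jacobi_sn_def)
  have cnv': "jacobi_cn e v = f / e * (sqrt (1 - e\<^sup>2) / sqrt (1 - f\<^sup>2))"
    unfolding cnv S1 using e f by (simp add: real_sqrt_mult real_sqrt_divide)
  have dnv': "jacobi_dn e v = sqrt (1 - e\<^sup>2) / sqrt (1 - f\<^sup>2)"
    unfolding dnv eS by (simp add: real_sqrt_divide)
  have cnpos: "0 < jacobi_cn e v" and snpos: "0 < jacobi_sn e v"
    using S by (auto simp: snv cnv)
  have ratio: "jacobi_dn e v / jacobi_cn e v = e / f" "sqrt (1 - f\<^sup>2) / f = sqrt (1 - e\<^sup>2) / e / jacobi_cn e v"
    using e f e2 f2 by (simp_all add: cnv' dnv')
  \<comment> \<open>The same point in the coordinates that turn the caustic into the unit circle.\<close>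
  have coords: "ellipse_param f (jacobi_am e y) = ellipse_coords e
      (- (jacobi_dn e v / jacobi_cn e v * jacobi_sn e y)) (1 / jacobi_cn e v * jacobi_cn e y)" for y
    unfolding ratio(1) ellipse_param_def ellipse_coords_def ratio(2)
    using e f by (simp add: jacobi_sn_def jacobi_cn_def)
  \<comment> \<open>The distance from the end with parameter \<open>x\<close> to the point of tangency.\<close>
  define h where "h x = jacobi_sn e v * jacobi_dn e x / jacobi_cn e v" for x
  have hpos: "0 < h x" for x using cnpos snpos dn_pos by (simp add: h_def)
  have hc: "jacobi_cn e v * h x = jacobi_sn e v * jacobi_dn e x" for x
    using cnpos by (simp add: h_def)
  have cancel: "a / jacobi_cn e v * b = d" if "a * b = jacobi_cn e v * d" for a b d
    using that cnpos by simp
  have chord_end: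
    "jacobi_dn e v / jacobi_cn e v * jacobi_sn e (m + v) = jacobi_sn e m + h (m + v) * jacobi_cn e m"
    "1 / jacobi_cn e v * jacobi_cn e (m + v) = jacobi_cn e m - h (m + v) * jacobi_sn e m"
    by (rule cancel, use sn_add_dn[of v m] cn_add_dn[of m v] hc[of "m + v"] in algebra)+
  have chord_start:
    "jacobi_dn e v / jacobi_cn e v * jacobi_sn e (m - v) = jacobi_sn e m - h (m - v) * jacobi_cn e m"
    "1 / jacobi_cn e v * jacobi_cn e (m - v) = jacobi_cn e m + h (m - v) * jacobi_sn e m"
    by (rule cancel, use sn_add_dn[of "- v" m, simplified] cn_add_dn[of m "- v", simplified] hc[of "m - v"] in algebra)+
  have "poncelet_map e f (ellipse_param f (jacobi_am e (m - v))) = ellipse_param f (jacobi_am e (m + v))"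
  proof (rule poncelet_map_eqI[OF f e])
    show "(- jacobi_sn e m)\<^sup>2 + (jacobi_cn e m)\<^sup>2 = 1" using sn_cn_squared by simp
    show "0 < h (m - v)" "0 < h (m + v)" by (rule hpos)+
    show "ellipse_param f (jacobi_am e (m - v)) = ellipse_coords e
        (- jacobi_sn e m + h (m - v) * jacobi_cn e m) (jacobi_cn e m - h (m - v) * - jacobi_sn e m)"
      unfolding coords chord_start by simp
    show "ellipse_param f (jacobi_am e (m + v)) = ellipse_coords e
        (- jacobi_sn e m - h (m + v) * jacobi_cn e m) (jacobi_cn e m + h (m + v) * - jacobi_sn e m)"
      unfolding coords chord_end by simp
  qed (rule ellipse_param_mem[OF f])+
  moreover have "m - v = u" "m + v = u + 2 * v" by (simp_all add: m_def)
  ultimately show ?thesis unfolding v_def[symmetric] by (simp only:)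
qed

section \<open>Continuous parametrizations of an ellipse\<close>

lemma integer_valued_continuous_constant:
  fixes h :: "real \<Rightarrow> real"
  assumes "continuous_on UNIV h" "\<And>x. h x \<in> \<int>"
  obtains m :: int where "\<And>x. h x = of_int m"
proof -
  have "h constant_on UNIV"
  proof (rule continuous_discrete_range_constant[OF connected_UNIV assms(1)])
    fix x :: real
    have "1 \<le> norm (h y - h x)" if "h y \<noteq> h x" for y
      using Ints_nonzero_abs_ge1[of "h y - h x"] assms(2) that by simp
    then show "\<exists>e>0. \<forall>y. y \<in> UNIV \<and> h y \<noteq> h x \<longrightarrow> e \<le> norm (h y - h x)"
      using zero_less_one by blast
  qed
  then obtain c where c: "\<And>x. h x = c" by (auto simp: constant_on_def)
  moreover obtain m where "c = of_int m" using assms(2)[of 0] c by (auto elim: Ints_cases)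
  ultimately show ?thesis using that by blast
qed

lemma ellipse_param_eq_iff:
  assumes "0 < \<epsilon>" "\<epsilon> < 1"
  shows "ellipse_param \<epsilon> \<theta> = ellipse_param \<epsilon> \<phi> \<longleftrightarrow> (\<theta> - \<phi>) / (2 * pi) \<in> \<int>"
proof -
  have "ellipse_param \<epsilon> \<theta> = ellipse_param \<epsilon> \<phi> \<longleftrightarrow> sin \<theta> = sin \<phi> \<and> cos \<theta> = cos \<phi>"
    by (simp add: ellipse_param_def ellipse_coords_inject[OF assms])
  also have "\<dots> \<longleftrightarrow> (\<exists>n::int. \<theta> = \<phi> + 2 * pi * n)"
    using sin_cos_eq_iff[of \<theta> \<phi>] by auto
  also have "\<dots> \<longleftrightarrow> (\<theta> - \<phi>) / (2 * pi) \<in> \<int>"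
    by (auto simp: field_simps Ints_def image_iff)
  finally show ?thesis .
qed

lemma ellipse_param_surj:
  assumes "0 < \<epsilon>" "\<epsilon> < 1" and "p \<in> conf_ellipse \<epsilon>"
  obtains \<theta> where "p = ellipse_param \<epsilon> \<theta>"
proof -
  obtain X Y where p: "p = ellipse_coords \<epsilon> X Y" using ellipse_coords_exist[OF assms(1,2)] .
  have "Y\<^sup>2 + (- X)\<^sup>2 = 1"
    using assms p by (simp add: conf_ellipse_def conic_form_own_coords add.commute)
  then obtain \<theta> where "Y = cos \<theta>" "- X = sin \<theta>" using sincos_total_2pi by metis
  then have "p = ellipse_param \<epsilon> \<theta>" by (simp add: p ellipse_param_def flip: \<open>- X = sin \<theta>\<close>)
  then show ?thesis by (rule that)
qed

text \<open>Interpolating the semi-axes linearly to \<open>1\<close> deforms the loop inside the punctured plane into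
\<open>\<i> * exp (\<i> * \<theta>)\<close>, whose winding number is read off from the exponent.\<close>

lemma winding_number_ellipse_param:
  assumes \<epsilon>: "0 < \<epsilon>" "\<epsilon> < 1" and \<theta>: "continuous_on {0..1} \<theta>"
    and m: "\<theta> 1 = \<theta> 0 + 2 * pi * of_int m"
  shows "winding_number (\<lambda>t. Complex (fst (ellipse_param \<epsilon> (\<theta> t))) (snd (ellipse_param \<epsilon> (\<theta> t)))) 0
      = of_int m"
proof -
  define a b where "a = 1 / \<epsilon>" and "b = sqrt (1 - \<epsilon>\<^sup>2) / \<epsilon>"
  have ab: "0 < a" "0 < b" using \<epsilon> square_less_1[OF \<epsilon>] by (auto simp: a_def b_def)
  define g where "g t = Complex (- a * sin (\<theta> t)) (b * cos (\<theta> t))" for t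
  define q where "q t = \<i> * of_real (\<theta> t + pi / 2)" for t
  define h where "h = exp \<circ> q"
  have h: "h t = Complex (- sin (\<theta> t)) (cos (\<theta> t))" for t
    by (simp add: h_def q_def complex_eq_iff sin_add cos_add Re_exp Im_exp)
  have q: "path q" unfolding path_def q_def by (intro continuous_intros \<theta>)
  have loop: "sin (\<theta> 1) = sin (\<theta> 0)" "cos (\<theta> 1) = cos (\<theta> 0)"
    using m sin_cos_eq_iff[of "\<theta> 1" "\<theta> 0"] by auto
  have "homotopic_loops (- {0}) g h"
  proof (rule homotopic_loops_linear)
    show "path g" unfolding path_def g_def Complex_eq by (intro continuous_intros \<theta>)
    show "path h" unfolding path_def h Complex_eq by (intro continuous_intros \<theta>)
    show "pathfinish g = pathstart g" "pathfinish h = pathstart h"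
      using loop by (auto simp: pathfinish_def pathstart_def g_def h)
  next
    fix t :: real assume "t \<in> {0..1}"
    show "closed_segment (g t) (h t) \<subseteq> - {0}"
    proof
      fix z assume "z \<in> closed_segment (g t) (h t)"
      then obtain u where u: "0 \<le> u" "u \<le> 1" and z: "z = (1 - u) *\<^sub>R g t + u *\<^sub>R h t"
        by (auto simp: closed_segment_def)
      have pos: "0 < (1 - u) * a + u" "0 < (1 - u) * b + u"
        using u ab by (cases "u = 0"; simp add: add_nonneg_pos)+
      have "Re z = - ((1 - u) * a + u) * sin (\<theta> t)" "Im z = ((1 - u) * b + u) * cos (\<theta> t)"
        by (simp_all add: z g_def h algebra_simps)
      then have "z = 0 \<Longrightarrow> sin (\<theta> t) = 0 \<and> cos (\<theta> t) = 0" using pos by auto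
      then show "z \<in> - {0}" using sin_zero_norm_cos_one by fastforce
    qed
  qed
  then have "winding_number g 0 = winding_number h 0" by (rule winding_number_homotopic_loops)
  also have "\<dots> = (pathfinish q - pathstart q) / (2 * of_real pi * \<i>)"
    unfolding h_def by (rule winding_number_compose_exp[OF q])
  also have "\<dots> = of_int m"
    by (simp add: pathfinish_def pathstart_def q_def m field_simps)
  finally show ?thesis
    by (simp add: g_def[abs_def] ellipse_param_def ellipse_coords_def a_def b_def)
qed

text \<open>Every admissible coordinate has a continuous angle function, the imaginary part of a logarithm
along the simply connected line. The winding number condition makes the angle grow by exactly one
turn per period, rather than by another multiple of \<open>2 * \<pi>\<close>.\<close>

lemma circle_coordinate_lift:
  assumes \<epsilon>: "0 < \<epsilon>" "\<epsilon> < 1" and c: "circle_coordinate (conf_ellipse \<epsilon>) c"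
  obtains \<theta> where "continuous_on UNIV \<theta>" "\<And>x. c x = ellipse_param \<epsilon> (\<theta> x)"
    "\<And>x. \<theta> (x + 1) = \<theta> x + 2 * pi"
proof -
  have cont: "continuous_on UNIV c" and range: "range c = conf_ellipse \<epsilon>"
    and inj: "\<And>s t. c s = c t \<longleftrightarrow> s - t \<in> \<int>"
    and wind: "winding_number (\<lambda>t. Complex (fst (c t)) (snd (c t))) 0 = 1"
    using c by (auto simp: circle_coordinate_def)
  define b where "b = sqrt (1 - \<epsilon>\<^sup>2) / \<epsilon>"
  have b: "0 < b" using \<epsilon> square_less_1[OF \<epsilon>] by (simp add: b_def)
  define U where "U x = Complex (snd (c x) / b) (- \<epsilon> * fst (c x))" for x
  have U: "U x = exp (\<i> * of_real \<theta>)" if "c x = ellipse_param \<epsilon> \<theta>" for x \<theta>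
    using that \<epsilon> b
    by (simp add: U_def ellipse_param_def ellipse_coords_def b_def[symmetric] complex_eq_iff Re_exp Im_exp)
  have on: "\<exists>\<theta>. c x = ellipse_param \<epsilon> \<theta>" for x
    using ellipse_param_surj[OF \<epsilon>, of "c x"] range by blast
  have "continuous_on UNIV U"
    unfolding U_def Complex_eq by (intro continuous_intros cont) (use b in auto)
  moreover have "U x \<noteq> 0" for x using on[of x] U exp_not_eq_zero by metis
  ultimately obtain g where g: "continuous_on UNIV g" "\<And>x. U x = exp (g x)"
    using continuous_logarithm_on_contractible[of UNIV U] contractible_UNIV by auto
  define \<theta> where "\<theta> x = Im (g x)" for x
  have lift: "c x = ellipse_param \<epsilon> (\<theta> x)" for x
  proof -
    obtain \<phi> where \<phi>: "c x = ellipse_param \<epsilon> \<phi>" using on by blast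
    then have "exp (g x) = exp (\<i> * of_real \<phi>)" using U g(2) by metis
    then obtain n :: int where "g x = \<i> * of_real \<phi> + (of_int (2 * n) * pi) * \<i>" by (auto simp: exp_eq)
    then have "\<theta> x = \<phi> + 2 * pi * of_int n" by (simp add: \<theta>_def)
    then show ?thesis unfolding \<phi> by (simp add: ellipse_param_eq_iff[OF \<epsilon>] field_simps)
  qed
  have \<theta>: "continuous_on UNIV \<theta>" unfolding \<theta>_def by (intro continuous_intros g)
  have "continuous_on UNIV (\<lambda>x. (\<theta> (x + 1) - \<theta> x) / (2 * pi))"
    by (intro continuous_intros continuous_on_compose2[OF \<theta>]) auto
  moreover have "(\<theta> (x + 1) - \<theta> x) / (2 * pi) \<in> \<int>" for x
    using inj[of "x + 1" x] unfolding lift ellipse_param_eq_iff[OF \<epsilon>] by simp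
  ultimately obtain m :: int where m: "\<And>x. (\<theta> (x + 1) - \<theta> x) / (2 * pi) = of_int m"
    using integer_valued_continuous_constant[of "\<lambda>x. (\<theta> (x + 1) - \<theta> x) / (2 * pi)"] by blast
  have step: "\<theta> (x + 1) = \<theta> x + 2 * pi * of_int m" for x
    using m[of x] by (simp add: field_simps)
  have "winding_number (\<lambda>t. Complex (fst (c t)) (snd (c t))) 0 = of_int m"
    unfolding lift
    by (rule winding_number_ellipse_param[OF \<epsilon>])
       (use \<theta> step[of 0] in \<open>auto intro: continuous_on_subset\<close>)
  then have "m = 1" using wind by (metis of_int_eq_1_iff)
  with \<theta> lift step that show ?thesis by simp
qed

section \<open>The rotation number\<close>

text \<open>\<open>h\<close> semi-conjugates \<open>G\<close> to a translation and stays within bounded distance of the identity, because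
\<open>h y - y\<close> is continuous and periodic. So the orbits of \<open>G\<close> and of the translation by \<open>a\<close> drift apart by a bounded amount.\<close>

lemma linear_growth_limit:
  fixes h :: "real \<Rightarrow> real"
  assumes cont: "continuous_on UNIV h" and per: "\<And>x. h (x + 1) = h x + 1"
    and trans: "\<And>x. h (G x) = h x + a"
  shows "(\<lambda>n. ((G ^^ n) x - x) / real n) \<longlonglongrightarrow> a"
proof -
  define d where "d y = h y - y" for y
  have "bounded (d ` {0..1})"
    unfolding d_def
    by (intro compact_imp_bounded compact_continuous_image continuous_intros
        continuous_on_subset[OF cont]) auto
  then obtain B where "\<forall>z \<in> d ` {0..1}. norm z \<le> B"
    unfolding bounded_iff by blast
  then have B: "\<bar>d y\<bar> \<le> B" if "y \<in> {0..1}" for y using that by simp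
  have d_int: "d (y + of_int n) = d y" for y and n :: int
  proof (induction n rule: int_induct[where k = 0])
    case (step1 i)
    then show ?case using per[of "y + of_int i"] by (simp add: d_def algebra_simps)
  next
    case (step2 i)
    then show ?case using per[of "y + of_int (i - 1)"] by (simp add: d_def algebra_simps)
  qed simp
  have bound: "\<bar>d y\<bar> \<le> B" for y
  proof -
    have "d y = d (frac y)" using d_int[of "frac y" "\<lfloor>y\<rfloor>"] by (simp add: frac_def)
    then show ?thesis using B[of "frac y"] by (simp add: frac_lt_1 less_imp_le)
  qed
  have iter: "h ((G ^^ n) x) = h x + real n * a" for n
    by (induction n) (auto simp: trans algebra_simps)
  have "(\<lambda>n. ((G ^^ n) x - x) / real n - a) \<longlonglongrightarrow> 0"
  proof (rule Lim_null_comparison)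
    show "(\<lambda>n. 2 * B / real n) \<longlonglongrightarrow> 0" by (rule lim_const_over_n)
    show "\<forall>\<^sub>F n in sequentially. norm (((G ^^ n) x - x) / real n - a) \<le> 2 * B / real n"
    proof (rule eventually_sequentiallyI[of 1])
      fix n :: nat assume n: "1 \<le> n"
      have "((G ^^ n) x - x) / real n - a = (d x - d ((G ^^ n) x)) / real n"
        using n iter[of n] by (simp add: d_def field_simps)
      then have "norm (((G ^^ n) x - x) / real n - a) = \<bar>d x - d ((G ^^ n) x)\<bar> / real n" by simp
      also have "\<dots> \<le> 2 * B / real n"
        using bound[of x] bound[of "(G ^^ n) x"] by (intro divide_right_mono) linarith+
      finally show "norm (((G ^^ n) x - x) / real n - a) \<le> 2 * B / real n" .
    qed
  qed
  then show ?thesis by (rule LIM_zero_cancel)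
qed

theorem theorem1:
  fixes e f :: real
  assumes "0 < f" and "f < e" and "e < 1"
  shows "has_rotation_number (conf_ellipse f) (poncelet_map e f)
           (ellipticF (rotation_angle e f) e / (2 * ellipticK e))"
proof -
  have f: "0 < f" "f < 1" and e: "0 < e" "e < 1" using assms by auto
  interpret elliptic_modulus e by unfold_locales (rule square_less_1[OF e])
  define K where "K = ellipticK e"
  define v where "v = ellipticF (rotation_angle e f) e"
  define \<rho> where "\<rho> = v / (2 * K)"
  have K: "0 < K" unfolding K_def by (rule ellipticK_pos)
  \<comment> \<open>In this coordinate the billiard map is the rotation by \<open>\<rho>\<close>.\<close>
  define c where "c t = ellipse_param f (jacobi_am e (4 * K * t))" for t
  have map_c: "poncelet_map e f (c t) = c (t + \<rho>)" for t
    using poncelet_map_ellipse_param[OF assms, of "4 * K * t"] K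
    by (simp add: c_def \<rho>_def v_def distrib_left)
  have \<rho>01: "0 \<le> \<rho>" "\<rho> < 1"
  proof -
    \<comment> \<open>The amplitude lies between \<open>0\<close> and \<open>\<pi> / 2\<close>, so \<open>\<rho>\<close> is even at most \<open>1 / 2\<close>.\<close>
    define S where "S = (e\<^sup>2 - f\<^sup>2) / (e\<^sup>2 * (1 - f\<^sup>2))"
    have "f\<^sup>2 < e\<^sup>2" "f\<^sup>2 < 1" using assms square_less_1[OF f] by (simp_all add: power_strict_mono)
    have "0 \<le> S" unfolding S_def using \<open>f\<^sup>2 < e\<^sup>2\<close> \<open>f\<^sup>2 < 1\<close> by simp
    moreover have "S \<le> 1"
    proof -
      have "e\<^sup>2 * f\<^sup>2 \<le> 1 * f\<^sup>2" using square_less_1[OF e] by (intro mult_right_mono) auto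
      then show ?thesis unfolding S_def using e \<open>f\<^sup>2 < 1\<close> by (simp add: divide_le_eq algebra_simps)
    qed
    ultimately have sqrtS: "0 \<le> sqrt S" "sqrt S \<le> 1" by simp_all
    then have "- 1 \<le> sqrt S" by linarith
    have "0 \<le> rotation_angle e f" "rotation_angle e f \<le> pi / 2"
      unfolding rotation_angle_def S_def[symmetric]
      using arcsin_le_arcsin[of 0 "sqrt S"] arcsin_ubound[OF \<open>- 1 \<le> sqrt S\<close> sqrtS(2)] sqrtS by simp_all
    moreover have "mono (\<lambda>\<phi>. ellipticF \<phi> e)"
      using ellipticF_strict_mono by (rule strict_mono_mono)
    ultimately have "ellipticF 0 e \<le> v" "v \<le> K"
      unfolding v_def K_def ellipticK_def by (blast dest: monoD)+
    then have "0 \<le> v" "v < 2 * K" using K by simp_all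
    then show "0 \<le> \<rho>" "\<rho> < 1" using K by (simp_all add: \<rho>_def)
  qed
  have coord: "c s = c t \<longleftrightarrow> s - t \<in> \<int>" for s t
  proof -
    have "c s = c t \<longleftrightarrow> (\<exists>n::int. jacobi_am e (4 * K * s) = jacobi_am e (4 * K * t) + 2 * pi * of_int n)"
      unfolding c_def ellipse_param_eq_iff[OF f] by (auto simp: field_simps Ints_def image_iff)
    also have "\<dots> \<longleftrightarrow> (\<exists>n::int. 4 * K * s = 4 * K * t + 4 * K * of_int n)"
      unfolding K_def by (metis am_shift_periods ellipticF_am)
    also have "\<dots> \<longleftrightarrow> (\<exists>n::int. s = t + of_int n)"
      using K by (simp add: distrib_left[symmetric])
    also have "\<dots> \<longleftrightarrow> s - t \<in> \<int>"
      by (metis Ints_cases Ints_of_int add.commute add_diff_cancel_left' diff_add_cancel)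
    finally show ?thesis .
  qed
  have "continuous_on UNIV (jacobi_am e)"
    by (intro continuous_at_imp_continuous_on ballI am_continuous)
  then have am_cont: "continuous_on UNIV (\<lambda>t. jacobi_am e (4 * K * t))"
    by (rule continuous_on_compose2) (auto intro: continuous_intros)
  have "circle_coordinate (conf_ellipse f) c"
    unfolding circle_coordinate_def
  proof (intro conjI allI)
    show "continuous_on UNIV c"
      unfolding c_def ellipse_param_def ellipse_coords_def
      by (intro continuous_intros am_cont) (use f in auto)
    show "range c = conf_ellipse f"
    proof
      show "range c \<subseteq> conf_ellipse f" using ellipse_param_mem[OF f] by (auto simp: c_def)
      show "conf_ellipse f \<subseteq> range c"
      proof
        fix p assume "p \<in> conf_ellipse f"
        then obtain \<theta> where "p = ellipse_param f \<theta>" using ellipse_param_surj[OF f] by blast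
        then have "p = c (ellipticF \<theta> e / (4 * K))" using K by (simp add: c_def)
        then show "p \<in> range c" by blast
      qed
    qed
    show "c s = c t \<longleftrightarrow> s - t \<in> \<int>" for s t by (rule coord)
    have "winding_number (\<lambda>t. Complex (fst (c t)) (snd (c t))) 0 = of_int 1"
      unfolding c_def
    proof (rule winding_number_ellipse_param[OF f])
      show "continuous_on {0..1} (\<lambda>t. jacobi_am e (4 * K * t))"
        using am_cont by (rule continuous_on_subset) simp
      show "jacobi_am e (4 * K * 1) = jacobi_am e (4 * K * 0) + 2 * pi * of_int 1"
        using am_shift_periods[of 0 1] by (simp add: K_def)
    qed
    then show "winding_number (\<lambda>t. Complex (fst (c t)) (snd (c t))) 0 = 1" by simp
  qed
  moreover have "circle_lift c (poncelet_map e f) (\<lambda>t. t + \<rho>)"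
    unfolding circle_lift_def by (auto intro!: continuous_intros simp: strict_mono_def map_c)
  moreover have "\<exists>L. (\<lambda>n. ((G ^^ n) x - x) / real n) \<longlonglongrightarrow> L \<and> frac L = \<rho>"
    if c': "circle_coordinate (conf_ellipse f) c'" and G: "circle_lift c' (poncelet_map e f) G"
    for c' G x
  proof -
    obtain \<theta> where \<theta>: "continuous_on UNIV \<theta>" and c'\<theta>: "\<And>x. c' x = ellipse_param f (\<theta> x)"
      and \<theta>1: "\<And>x. \<theta> (x + 1) = \<theta> x + 2 * pi"
      using circle_coordinate_lift[OF f c'] by blast
    \<comment> \<open>A lift of the change from the coordinate \<open>c'\<close> to \<open>c\<close>.\<close>
    define h where "h x = ellipticF (\<theta> x) e / (4 * K)" for x
    have F: "continuous_on UNIV (\<lambda>\<phi>. ellipticF \<phi> e)"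
      by (intro continuous_at_imp_continuous_on ballI ellipticF_continuous)
    have h: "continuous_on UNIV h"
      unfolding h_def by (intro continuous_intros continuous_on_compose2[OF F \<theta>]) (use K in auto)
    have ch: "c (h x) = c' x" for x using K by (simp add: c_def h_def c'\<theta>)
    have h1: "h (x + 1) = h x + 1" for x
      using K ellipticF_shift_period[of "\<theta> x"] by (simp add: h_def \<theta>1 add_divide_distrib flip: K_def)
    have contG: "continuous_on UNIV G" and Gc': "\<And>x. c' (G x) = poncelet_map e f (c' x)"
      using G by (auto simp: circle_lift_def)
    \<comment> \<open>Both \<open>h (G x)\<close> and \<open>h x + \<rho>\<close> are coordinates of the image of \<open>c' x\<close>.\<close>
    have "h (G x) - (h x + \<rho>) \<in> \<int>" for x
      unfolding coord[symmetric] ch Gc' map_c[symmetric] ..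
    moreover have "continuous_on UNIV (\<lambda>x. h (G x) - (h x + \<rho>))"
      by (intro continuous_intros h continuous_on_compose2[OF h contG]) auto
    ultimately obtain m :: int where m: "\<And>x. h (G x) - (h x + \<rho>) = of_int m"
      using integer_valued_continuous_constant[of "\<lambda>x. h (G x) - (h x + \<rho>)"] by blast
    have "h (G x) = h x + (\<rho> + of_int m)" for x using m[of x] by simp
    from linear_growth_limit[OF h h1 this]
    have "(\<lambda>n. ((G ^^ n) x - x) / real n) \<longlonglongrightarrow> \<rho> + of_int m" .
    moreover have "frac (\<rho> + of_int m) = \<rho>" using \<rho>01 by (simp add: frac_unique_iff)
    ultimately show ?thesis by blast
  qed
  ultimately show ?thesis
    unfolding has_rotation_number_def \<rho>_def v_def K_def by blast
qed

end
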